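(* Let $W$ be a minimal collection of free ultrafilters on $\mathbb{N}$ and let $\mathfrak{F}=\cap W$. Then: (a) each $\mathfrak{U}\in W$ is inavoidable for $\mathfrak{F}$; (b) consequently, $\mathfrak{F}$ has no minimal representation other than $W$; that is, if $W'$ is a minimal collection of free ultrafilters with $\cap W'=\mathfrak{F}$, then $W'=W$.
   Context: Filters on $\mathbb{N}$ are proper; a filter is free if it contains every subset of $\mathbb{N}$ with finite complement; an ultrafilter is a maximal filter. For a collection $W$ of filters, $\cap W=\{B\subset\mathbb{N} : B\in\mathfrak{U}\ \text{for all}\ \mathfrak{U}\in W\}$. A collection $W$ of free ultrafilters is a representation of a filter $\mathfrak{F}$ if $\cap W=\mathfrak{F}$. A collection $W$ of free ultrafilters consisting of at least two elements is minimal if $\cap W\neq\cap(W\setminus\{\mathfrak{U}\})$ for every $\mathfrak{U}\in W$; a minimal representation of $\mathfrak{F}$ is a representation of $\mathfrak{F}$ that is a minimal collection. A free ultrafilter $\mathfrak{U}$ is inavoidable for a free filter $\mathfrak{F}$ if every representation $W$ of $\mathfrak{F}$ contains $\mathfrak{U}$ as an element. *)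

theory Defs
  imports Complex_Main
begin

(* The library type nat filter also contains the improper filter bot, and its
   order is reverse inclusion: F \<le> G means that every set of G is a set of F.
   Hence intersecting a collection W of filters is Sup W in the library. The
   lemmas below record this in terms of families of subsets. *)

definition filter_sets :: "nat filter \<Rightarrow> nat set set" where
  "filter_sets F = {B. eventually (\<lambda>n. n \<in> B) F}"

lemma filter_sets_Sup: "filter_sets (Sup W) = {B. \<forall>U\<in>W. B \<in> filter_sets U}"
  by (simp add: filter_sets_def eventually_Sup)

lemma filter_sets_subset_iff: "filter_sets F \<subseteq> filter_sets G \<longleftrightarrow> G \<le> F"
proof
  assume *: "filter_sets F \<subseteq> filter_sets G"
  show "G \<le> F"
    unfolding le_filter_def
  proof (intro allI impI)
    fix P assume "eventually P F"
    then have "Collect P \<in> filter_sets F" by (simp add: filter_sets_def)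
    with * have "Collect P \<in> filter_sets G" by blast
    then show "eventually P G" by (simp add: filter_sets_def)
  qed
qed (auto simp: filter_sets_def le_filter_def)

lemma filter_sets_inject: "filter_sets F = filter_sets G \<longleftrightarrow> F = G"
  by (metis filter_sets_subset_iff order_antisym order_refl)

lemma filter_sets_proper_iff: "F \<noteq> bot \<longleftrightarrow> {} \<notin> filter_sets F"
  by (simp add: filter_sets_def trivial_limit_def)

lemma filter_sets_of_family:
  assumes "UNIV \<in> \<F>"
    and "\<And>A B. A \<in> \<F> \<Longrightarrow> B \<in> \<F> \<Longrightarrow> A \<inter> B \<in> \<F>"
    and "\<And>A B. A \<in> \<F> \<Longrightarrow> A \<subseteq> B \<Longrightarrow> B \<in> \<F>"
  shows "\<exists>F. filter_sets F = \<F>"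
proof -
  have "is_filter (\<lambda>P. Collect P \<in> \<F>)"
  proof
    show "{x. True} \<in> \<F>" using assms(1) by simp
  next
    fix P Q assume "Collect P \<in> \<F>" "Collect Q \<in> \<F>"
    then show "{x. P x \<and> Q x} \<in> \<F>" using assms(2) by (simp add: Collect_conj_eq)
  next
    fix P Q :: "nat \<Rightarrow> bool"
    assume "\<forall>x. P x \<longrightarrow> Q x" "Collect P \<in> \<F>"
    then show "Collect Q \<in> \<F>" using assms(3) by blast
  qed
  then have "filter_sets (Abs_filter (\<lambda>P. Collect P \<in> \<F>)) = \<F>"
    by (simp add: filter_sets_def eventually_Abs_filter)
  then show ?thesis by blast
qed

definition free_filter :: "nat filter \<Rightarrow> bool" where
  "free_filter F \<longleftrightarrow> F \<noteq> bot \<and> (\<forall>B. finite (- B) \<longrightarrow> eventually (\<lambda>n. n \<in> B) F)"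

definition ultrafilter :: "nat filter \<Rightarrow> bool" where
  "ultrafilter F \<longleftrightarrow> F \<noteq> bot \<and> (\<forall>G. G \<noteq> bot \<and> G \<le> F \<longrightarrow> G = F)"

definition free_ultrafilter :: "nat filter \<Rightarrow> bool" where
  "free_ultrafilter U \<longleftrightarrow> ultrafilter U \<and> free_filter U"

definition representation :: "nat filter set \<Rightarrow> nat filter \<Rightarrow> bool" where
  "representation W F \<longleftrightarrow> F \<noteq> bot \<and> (\<forall>U\<in>W. free_ultrafilter U) \<and> Sup W = F"

definition minimal_collection :: "nat filter set \<Rightarrow> bool" where
  "minimal_collection W \<longleftrightarrow>
     (\<forall>U\<in>W. free_ultrafilter U) \<and> (\<exists>U\<in>W. \<exists>V\<in>W. U \<noteq> V) \<and>
     (\<forall>U\<in>W. Sup W \<noteq> Sup (W - {U}))"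

definition minimal_representation :: "nat filter set \<Rightarrow> nat filter \<Rightarrow> bool" where
  "minimal_representation W F \<longleftrightarrow> representation W F \<and> minimal_collection W"

definition inavoidable :: "nat filter \<Rightarrow> nat filter \<Rightarrow> bool" where
  "inavoidable U F \<longleftrightarrow>
     free_ultrafilter U \<and> free_filter F \<and> (\<forall>W. representation W F \<longrightarrow> U \<in> W)"

end

theory Submission
  imports Defs
begin

text \<open>
  Minimality of \<open>W\<close> says that each \<open>U \<in> W\<close> is isolated in \<open>W\<close>, seen as a subspace of the
  Stone space of ultrafilters: some set \<open>B\<close> belongs to every member of \<open>W\<close> except \<open>U\<close>
  (\<open>minimal_collection_separating_set\<close>). Such a \<open>B\<close> lies outside the intersection of \<open>W\<close>,
  so every collection \<open>W'\<close> with the same intersection has a member \<open>V\<close> that omits \<open>B\<close>, and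
  all that remains is to see that \<open>V\<close> must be \<open>U\<close>. For \<open>A \<in> U\<close>, the set \<open>A \<union> B\<close> belongs to
  every member of \<open>W\<close>: to \<open>U\<close> because of \<open>A\<close> and to the others because of \<open>B\<close>. Hence it
  belongs to \<open>V\<close>, and since the complement of \<open>B\<close> is in \<open>V\<close>, so is \<open>A\<close>. Thus \<open>V\<close> contains
  \<open>U\<close>, and maximality of \<open>U\<close> gives \<open>V = U\<close> (\<open>separated_ultrafilter_unavoidable\<close>).

  Uniqueness follows by symmetry: two minimal collections with the same intersection each
  consist of ultrafilters that the other one cannot avoid.
\<close>

text \<open>
  If the complement were compatible with \<open>U\<close>, adjoining it would yield a proper filter,
  which by maximality is \<open>U\<close> itself.
\<close>
lemma ultrafilter_not_eventually:
  assumes "ultrafilter U" and "\<not> eventually P U"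
  shows "eventually (\<lambda>n. \<not> P n) U"
proof -
  let ?G = "inf U (principal {n. \<not> P n})"
  have "?G \<noteq> bot"
    using assms(2) by (simp add: trivial_limit_def eventually_inf_principal)
  then have "?G = U"
    using assms(1) by (simp add: ultrafilter_def)
  moreover have "eventually (\<lambda>n. \<not> P n) ?G"
    by (simp add: eventually_inf_principal)
  ultimately show ?thesis by simp
qed

lemma minimal_collection_separating_set:
  assumes "minimal_collection W" and "U \<in> W"
  obtains P where "\<not> eventually P U" and "\<And>V. V \<in> W - {U} \<Longrightarrow> eventually P V"
proof -
  have "Sup W \<noteq> Sup (W - {U})"
    using assms by (simp add: minimal_collection_def)
  moreover have "Sup (W - {U}) \<le> Sup W"
    by (simp add: Sup_subset_mono)
  ultimately have "\<not> Sup W \<le> Sup (W - {U})"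
    by (metis order_antisym)
  then obtain P where P: "eventually P (Sup (W - {U}))" "\<not> eventually P (Sup W)"
    by (auto simp: le_filter_def)
  show thesis
  proof (rule that)
    show sep: "eventually P V" if "V \<in> W - {U}" for V
      using P(1) that by (simp add: eventually_Sup)
    show "\<not> eventually P U"
      using P(2) sep by (auto simp: eventually_Sup)
  qed
qed

text \<open>
  A set lying in all members of \<open>W\<close> but \<open>U\<close> makes \<open>U\<close> recoverable from the intersection of
  \<open>W\<close> alone: \<open>U\<close> is the only ultrafilter that contains this intersection and omits that set.
\<close>
lemma separated_ultrafilter_unavoidable:
  assumes U: "ultrafilter U" "\<not> eventually P U"
    and sep: "\<And>V. V \<in> W - {U} \<Longrightarrow> eventually P V"
    and "U \<in> W"
    and W': "\<And>V. V \<in> W' \<Longrightarrow> ultrafilter V" "Sup W' = Sup W"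
  shows "U \<in> W'"
proof -
  have "\<not> eventually P (Sup W')"
    using \<open>U \<in> W\<close> U(2) W'(2) by (auto simp: eventually_Sup)
  then obtain V where V: "V \<in> W'" "\<not> eventually P V"
    by (auto simp: eventually_Sup)
  have "V \<le> U"
    unfolding le_filter_def
  proof (intro allI impI)
    fix Q assume Q: "eventually Q U"
    have "eventually (\<lambda>n. Q n \<or> P n) G" if "G \<in> W" for G
    proof (cases "G = U")
      case True
      with Q show ?thesis by (auto elim: eventually_mono)
    next
      case False
      with sep that have "eventually P G" by blast
      then show ?thesis by (rule eventually_mono) simp
    qed
    then have "eventually (\<lambda>n. Q n \<or> P n) (Sup W')"
      by (simp add: W'(2) eventually_Sup)
    then have "eventually (\<lambda>n. Q n \<or> P n) V"
      using V(1) by (simp add: eventually_Sup)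
    moreover have "eventually (\<lambda>n. \<not> P n) V"
      using ultrafilter_not_eventually V W'(1) by blast
    ultimately show "eventually Q V"
      by eventually_elim blast
  qed
  moreover have "V \<noteq> bot"
    using W'(1)[OF V(1)] by (simp add: ultrafilter_def)
  ultimately have "V = U"
    using U(1) by (simp add: ultrafilter_def)
  with V(1) show ?thesis by simp
qed

lemma free_filter_Sup:
  assumes "W \<noteq> {}" and "\<And>U. U \<in> W \<Longrightarrow> free_filter U"
  shows "free_filter (Sup W)"
proof -
  obtain U where "U \<in> W" using assms(1) by blast
  then have "U \<le> Sup W" and "U \<noteq> bot"
    using assms(2) by (auto simp: free_filter_def Sup_upper)
  then have "Sup W \<noteq> bot" by (metis bot.extremum_uniqueI)
  then show ?thesis
    using assms(2) by (simp add: free_filter_def eventually_Sup)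
qed

lemma minimal_collection_inavoidable:
  assumes min: "minimal_collection W" and "U \<in> W"
  shows "inavoidable U (Sup W)"
proof -
  have free: "free_ultrafilter V" if "V \<in> W" for V
    using min that by (simp add: minimal_collection_def)
  obtain P where "\<not> eventually P U" "\<And>V. V \<in> W - {U} \<Longrightarrow> eventually P V"
    using minimal_collection_separating_set[OF assms] by blast
  then have "U \<in> W'" if "representation W' (Sup W)" for W'
    using that free \<open>U \<in> W\<close>
    by (intro separated_ultrafilter_unavoidable[of U P W W'])
       (auto simp: representation_def free_ultrafilter_def)
  moreover have "free_filter (Sup W)"
    using free \<open>U \<in> W\<close> by (intro free_filter_Sup) (auto simp: free_ultrafilter_def)
  ultimately show ?thesis
    using free \<open>U \<in> W\<close> by (simp add: inavoidable_def)
qed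

theorem theorem3p19:
  fixes W :: "nat filter set" and F :: "nat filter"
  assumes "minimal_collection W"
    and "F = Sup W"
  shows "(\<forall>U\<in>W. inavoidable U F) \<and>
         (\<forall>W'. minimal_representation W' F \<longrightarrow> W' = W)"
proof (intro conjI ballI allI impI)
  show "inavoidable U F" if "U \<in> W" for U
    using minimal_collection_inavoidable assms that by simp
next
  fix W' assume W': "minimal_representation W' F"
  then have rep': "representation W' F" and min': "minimal_collection W'" and F: "F = Sup W'"
    by (auto simp: minimal_representation_def representation_def)
  have rep: "representation W F"
    using rep' assms by (simp add: representation_def minimal_collection_def)
  show "W' = W"
  proof
    show "W' \<subseteq> W"
      using minimal_collection_inavoidable[OF min'] rep F by (auto simp: inavoidable_def)
    show "W \<subseteq> W'"
      using minimal_collection_inavoidable[OF assms(1)] rep' assms(2)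
      by (auto simp: inavoidable_def)
  qed
qed

end
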